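(* Let $G$ be a group. Then the following are equivalent: (i) $G$ is a group of finite $C$-width and every exhaustive chain $N_0\leq N_1\leq\ldots\leq N_k\leq\ldots\leq G$ of normal subgroups of $G$ (that is, every increasing chain $(N_k)_{k\in\mathbf N}$ of normal subgroups whose union is $G$) terminates after finitely many steps; (ii) every exhaustive chain $U_0\subseteq U_1\subseteq\ldots\subseteq U_k\subseteq\ldots\subseteq G$ of subsets of $G$ (that is, every increasing chain $(U_k)_{k\in\mathbf N}$ of subsets whose union is $G$) such that for every $i\in\mathbf N$ the set $U_i$ is closed under taking inverses, $U_i$ is conjugation-invariant, and the product $U_iU_i$ is contained in $U_k$ for a suitable $k$, terminates after finitely many steps; (iii) for every action of $G$ by isometries on a metric space $\langle M,d\rangle$ such that $$d(a,ghg^{-1}a)=d(a,ha)\qquad (a\in M;\ g,h\in G),$$ every orbit has bounded (i.e. finite) diameter; (iv) every function $L:G\to\mathbf R$ taking constant values on conjugacy classes of $G$ and such that $L(g)=0$ if and only if $g=1$, and $L(gh)\leq L(g)+L(h)$ for all $g,h\in G$, is bounded from above.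
   Context: For a group $G$ and a generating set $S$ of $G$, the length $|g|_S$ of $g\in G$ is the least number of elements of $S\cup S^{-1}$ whose product is $g$; the width of $G$ relative to $S$ is $\mathrm{wid}(G,S)=\sup\{|g|_S: g\in G\}$. A subset (in particular, a generating set) $S$ of $G$ is conjugation-invariant if $gSg^{-1}=S$ for all $g\in G$. The group $G$ is a group of finite $C$-width if $\mathrm{wid}(G,S)<\infty$ for every conjugation-invariant generating set $S$ of $G$. An exhaustive chain $(X_k)_{k\in\mathbf N}$ in $G$ terminates after finitely many steps if $X_m=G$ for some $m\in\mathbf N$. For a subset $U\subseteq G$, $UU=\{uv: u,v\in U\}$. *)

theory Defs
  imports
    "HOL-Algebra.Generated_Groups"
    "HOL-Algebra.Group_Action"
    "HOL-Analysis.Abstract_Metric_Spaces"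
    "HOL-Library.Extended_Nat"
begin

text \<open>The infimum is the minimum whenever \<open>g\<close> is a product of elements of \<open>S \<union> S\<inverse>\<close>, and \<open>\<infinity>\<close>
  otherwise.\<close>

definition word_length :: "('a, 'b) monoid_scheme \<Rightarrow> 'a set \<Rightarrow> 'a \<Rightarrow> enat" where
  "word_length G S g =
     Inf {enat (length ws) | ws.
       set ws \<subseteq> S \<union> m_inv G ` S \<and> foldr (mult G) ws \<one>\<^bsub>G\<^esub> = g}"

definition width :: "('a, 'b) monoid_scheme \<Rightarrow> 'a set \<Rightarrow> enat" where
  "width G S = (SUP g\<in>carrier G. word_length G S g)"

definition conjugation_invariant :: "('a, 'b) monoid_scheme \<Rightarrow> 'a set \<Rightarrow> bool" where
  "conjugation_invariant G S \<longleftrightarrow>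
     (\<forall>g\<in>carrier G. g <#\<^bsub>G\<^esub> S #>\<^bsub>G\<^esub> (inv\<^bsub>G\<^esub> g) = S)"

definition finite_C_width :: "('a, 'b) monoid_scheme \<Rightarrow> bool" where
  "finite_C_width G \<longleftrightarrow>
     (\<forall>S. S \<subseteq> carrier G \<longrightarrow> generate G S = carrier G \<longrightarrow> conjugation_invariant G S
        \<longrightarrow> width G S < \<infinity>)"

definition exhaustive_chain :: "('a, 'b) monoid_scheme \<Rightarrow> (nat \<Rightarrow> 'a set) \<Rightarrow> bool" where
  "exhaustive_chain G X \<longleftrightarrow> (\<forall>k. X k \<subseteq> X (Suc k)) \<and> (\<Union>k. X k) = carrier G"

definition terminates :: "('a, 'b) monoid_scheme \<Rightarrow> (nat \<Rightarrow> 'a set) \<Rightarrow> bool" where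
  "terminates G X \<longleftrightarrow> (\<exists>m. X m = carrier G)"

definition normal_chains_terminate :: "('a, 'b) monoid_scheme \<Rightarrow> bool" where
  "normal_chains_terminate G \<longleftrightarrow>
     (\<forall>N. exhaustive_chain G N \<longrightarrow> (\<forall>k. N k \<lhd> G) \<longrightarrow> terminates G N)"

definition invariant_subset_chains_terminate :: "('a, 'b) monoid_scheme \<Rightarrow> bool" where
  "invariant_subset_chains_terminate G \<longleftrightarrow>
     (\<forall>U. exhaustive_chain G U
        \<longrightarrow> (\<forall>i. (\<forall>u\<in>U i. inv\<^bsub>G\<^esub> u \<in> U i) \<and> conjugation_invariant G (U i)
              \<and> (\<exists>k. U i <#>\<^bsub>G\<^esub> U i \<subseteq> U k))
        \<longrightarrow> terminates G U)"

definition isometric_action ::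
    "('a, 'b) monoid_scheme \<Rightarrow> 'm set \<Rightarrow> ('m \<Rightarrow> 'm \<Rightarrow> real) \<Rightarrow> ('a \<Rightarrow> 'm \<Rightarrow> 'm) \<Rightarrow> bool" where
  "isometric_action G M d \<phi> \<longleftrightarrow>
     Metric_space M d \<and> group_action G M \<phi>
     \<and> (\<forall>g\<in>carrier G. \<forall>x\<in>M. \<forall>y\<in>M. d (\<phi> g x) (\<phi> g y) = d x y)"

text \<open>A condition quantifying over all metric spaces cannot be a single HOL formula, since a formula
  cannot quantify over types.  The following predicate covers the metric spaces whose underlying
  set is a subset of the type \<open>'m\<close>; the condition on all metric spaces is its conjunction over all
  types \<open>'m\<close>.  Correspondingly, ``another condition implies it'' is stated for an arbitrary type
  variable \<open>'m\<close>, while ``it implies another condition'' already follows from the instance at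
  the element type of the group.\<close>

definition class_invariant_actions_bounded ::
    "('a, 'b) monoid_scheme \<Rightarrow> 'm itself \<Rightarrow> bool" where
  "class_invariant_actions_bounded G (_ :: 'm itself) \<longleftrightarrow>
     (\<forall>(M :: 'm set) d \<phi>. isometric_action G M d \<phi>
        \<longrightarrow> (\<forall>a\<in>M. \<forall>g\<in>carrier G. \<forall>h\<in>carrier G.
              d a (\<phi> (g \<otimes>\<^bsub>G\<^esub> h \<otimes>\<^bsub>G\<^esub> inv\<^bsub>G\<^esub> g) a) = d a (\<phi> h a))
        \<longrightarrow> (\<forall>a\<in>M. \<exists>B. \<forall>x\<in>orbit G \<phi> a. \<forall>y\<in>orbit G \<phi> a. d x y \<le> B))"

text \<open>Neither symmetry \<open>L (g\<inverse>) = L g\<close> nor nonnegativity of \<open>L\<close> is required.\<close>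

definition class_length_functions_bounded :: "('a, 'b) monoid_scheme \<Rightarrow> bool" where
  "class_length_functions_bounded G \<longleftrightarrow>
     (\<forall>L :: 'a \<Rightarrow> real.
        (\<forall>g\<in>carrier G. \<forall>h\<in>carrier G. L (g \<otimes>\<^bsub>G\<^esub> h \<otimes>\<^bsub>G\<^esub> inv\<^bsub>G\<^esub> g) = L h)
        \<longrightarrow> (\<forall>g\<in>carrier G. L g = 0 \<longleftrightarrow> g = \<one>\<^bsub>G\<^esub>)
        \<longrightarrow> (\<forall>g\<in>carrier G. \<forall>h\<in>carrier G. L (g \<otimes>\<^bsub>G\<^esub> h) \<le> L g + L h)
        \<longrightarrow> bdd_above (L ` carrier G))"

end

theory Submission
  imports Defs
begin

text \<open>All four conditions say that a conjugation-invariant notion of size on \<open>G\<close> is bounded; the proof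
  translates between sizes given by word lengths, by chains of subsets, by length functions and by
  displacements \<open>d a (g a)\<close>.

  Finite width and termination of normal chains give termination of a chain \<open>U\<close> of subsets as
  follows. The subgroups generated by the \<open>U k\<close> form a chain of normal subgroups, so some \<open>U m\<close>
  generates \<open>G\<close>; it is conjugation-invariant, so every element is a product of at most \<open>n\<close> elements
  of \<open>U m\<close> for a fixed \<open>n\<close>, and products of bounded length stay inside a single member of the
  chain (\<open>chain_absorbs_bounded_words\<close>). Conversely, chains of normal subgroups are special chains
  of subsets, and for a conjugation-invariant generating set the balls of the word length form a
  chain of subsets, whose termination says that the width is finite.

  The remaining conditions are linked in a cycle. The sublevel sets of a length function, cut down to
  be closed under inverses, form a chain of subsets, so termination bounds the length function
  (\<open>subset_chains_imp_length_functions_bounded\<close>). The displacement of a point under an isometric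
  action is a length function, up to a correction that makes it vanish only at \<open>\<one>\<close>, so bounded
  length functions give bounded orbits on a metric space of any type
  (\<open>length_functions_imp_actions_bounded\<close>). To return from actions to chains, a chain is thinned out
  until the product of two elements of one member lies in the next. Then one plus the index of the first
  member containing \<open>g\<close>, replaced by \<open>0\<close> for \<open>g = \<one>\<close>, is a symmetric length function. It defines
  a left-invariant metric on \<open>G\<close> itself, and a bounded orbit of left translation forces the chain to
  terminate (\<open>actions_bounded_imp_subset_chains\<close>). The metric space used in this last step lives on the
  element type of \<open>G\<close>.\<close>

section \<open>Conjugation-invariant sets and chains\<close>

lemma (in group) conj_set_eq:
  assumes "S \<subseteq> carrier G" "g \<in> carrier G"
  shows "g <#\<^bsub>G\<^esub> S #>\<^bsub>G\<^esub> inv g = (\<lambda>s. g \<otimes> s \<otimes> inv g) ` S"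
  unfolding l_coset_def r_coset_def by auto

lemma (in group) conj_conj_inv:
  assumes "g \<in> carrier G" "s \<in> carrier G"
  shows "g \<otimes> (inv g \<otimes> s \<otimes> g) \<otimes> inv g = s"
proof -
  have "g \<otimes> (inv g \<otimes> s \<otimes> g) \<otimes> inv g = (g \<otimes> inv g) \<otimes> s \<otimes> (g \<otimes> inv g)"
    using assms by (simp only: m_assoc m_closed inv_closed)
  then show ?thesis
    using assms by simp
qed

lemma (in group) conj_mult:
  assumes "g \<in> carrier G" "x \<in> carrier G" "y \<in> carrier G"
  shows "g \<otimes> (x \<otimes> y) \<otimes> inv g = (g \<otimes> x \<otimes> inv g) \<otimes> (g \<otimes> y \<otimes> inv g)"
proof -
  have "(g \<otimes> x \<otimes> inv g) \<otimes> (g \<otimes> y \<otimes> inv g) = g \<otimes> (x \<otimes> ((inv g \<otimes> g) \<otimes> (y \<otimes> inv g)))"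
    using assms by (simp only: m_assoc m_closed inv_closed)
  then show ?thesis
    using assms by (simp add: m_assoc)
qed

lemma (in group) inv_conj:
  assumes "g \<in> carrier G" "x \<in> carrier G"
  shows "inv (g \<otimes> x \<otimes> inv g) = g \<otimes> inv x \<otimes> inv g"
  using assms by (simp add: inv_mult_group m_assoc)

text \<open>The inclusion \<open>g S g\<inverse> \<subseteq> S\<close> for all \<open>g\<close> is already equality: applied to \<open>g\<inverse>\<close> it exhibits every
  \<open>s \<in> S\<close> as the conjugate by \<open>g\<close> of the element \<open>g\<inverse> s g\<close> of \<open>S\<close>.\<close>

lemma (in group) conjugation_invariant_iff:
  assumes "S \<subseteq> carrier G"
  shows "conjugation_invariant G S \<longleftrightarrow> (\<forall>g\<in>carrier G. \<forall>s\<in>S. g \<otimes> s \<otimes> inv g \<in> S)"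
    (is "_ \<longleftrightarrow> ?closed")
proof
  assume inv: "conjugation_invariant G S"
  show ?closed
  proof (intro ballI)
    fix g s
    assume g: "g \<in> carrier G" and s: "s \<in> S"
    have "(\<lambda>s. g \<otimes> s \<otimes> inv g) ` S = S"
      using inv g conj_set_eq[OF assms g] unfolding conjugation_invariant_def by simp
    then show "g \<otimes> s \<otimes> inv g \<in> S"
      using s by blast
  qed
next
  assume closed: ?closed
  show "conjugation_invariant G S"
    unfolding conjugation_invariant_def
  proof
    fix g
    assume g: "g \<in> carrier G"
    have "s \<in> (\<lambda>s. g \<otimes> s \<otimes> inv g) ` S" if s: "s \<in> S" for s
    proof
      have "inv g \<otimes> s \<otimes> inv (inv g) \<in> S"
        using closed g s by blast
      then show "inv g \<otimes> s \<otimes> g \<in> S"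
        using g by simp
      show "s = g \<otimes> (inv g \<otimes> s \<otimes> g) \<otimes> inv g"
        using conj_conj_inv g s assms by auto
    qed
    then show "g <#\<^bsub>G\<^esub> S #>\<^bsub>G\<^esub> inv g = S"
      using closed g conj_set_eq[OF assms g] by auto
  qed
qed

lemma exhaustive_chain_mono:
  assumes "exhaustive_chain G X" "i \<le> j"
  shows "X i \<subseteq> X j"
  using assms lift_Suc_mono_le[of X i j] unfolding exhaustive_chain_def by blast

lemma exhaustive_chain_subset:
  "exhaustive_chain G X \<Longrightarrow> X k \<subseteq> carrier G"
  unfolding exhaustive_chain_def by blast

lemma exhaustive_chain_obtain:
  assumes "exhaustive_chain G X" "g \<in> carrier G"
  obtains k where "g \<in> X k"
  using assms unfolding exhaustive_chain_def by blast

lemma exhaustive_chain_Least: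
  assumes "exhaustive_chain G X" "g \<in> carrier G"
  shows "g \<in> X (LEAST n. g \<in> X n)"
proof -
  obtain k where "g \<in> X k"
    using exhaustive_chain_obtain[OF assms] .
  then show ?thesis
    by (rule LeastI)
qed

lemma exhaustive_chainI:
  assumes "\<And>k. X k \<subseteq> carrier G"
    and "\<And>k. X k \<subseteq> X (Suc k)"
    and "\<And>g. g \<in> carrier G \<Longrightarrow> \<exists>k. g \<in> X k"
  shows "exhaustive_chain G X"
proof -
  have "(\<Union>k. X k) = carrier G"
  proof
    show "carrier G \<subseteq> (\<Union>k. X k)"
      using assms(3) by auto
  qed (intro UN_least assms(1))
  then show ?thesis
    unfolding exhaustive_chain_def using assms(2) by simp
qed

lemma set_mult_subset_iff:
  "A <#>\<^bsub>G\<^esub> B \<subseteq> C \<longleftrightarrow> (\<forall>a\<in>A. \<forall>b\<in>B. a \<otimes>\<^bsub>G\<^esub> b \<in> C)"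
  unfolding set_mult_def by blast

lemma (in group) invariant_subset_chains_terminateD:
  assumes ii: "invariant_subset_chains_terminate G"
    and U: "exhaustive_chain G U"
    and "\<And>i u. u \<in> U i \<Longrightarrow> inv u \<in> U i"
    and "\<And>i g u. g \<in> carrier G \<Longrightarrow> u \<in> U i \<Longrightarrow> g \<otimes> u \<otimes> inv g \<in> U i"
    and "\<And>i. \<exists>k. \<forall>u\<in>U i. \<forall>v\<in>U i. u \<otimes> v \<in> U k"
  shows "terminates G U"
  using ii assms(2-)
  unfolding invariant_subset_chains_terminate_def
  by (simp add: conjugation_invariant_iff[OF exhaustive_chain_subset[OF U]] set_mult_subset_iff)

section \<open>Word length\<close>

text \<open>An infimum in the extended naturals is attained unless the set is empty, in which case it is \<open>\<infinity>\<close>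
  and hence not below any finite bound.\<close>

lemma word_length_le_iff:
  "word_length G S g \<le> enat n \<longleftrightarrow>
     (\<exists>ws. set ws \<subseteq> S \<union> m_inv G ` S \<and> foldr (mult G) ws \<one>\<^bsub>G\<^esub> = g \<and> length ws \<le> n)"
    (is "_ \<longleftrightarrow> ?word")
proof
  let ?A = "{enat (length ws) | ws.
       set ws \<subseteq> S \<union> m_inv G ` S \<and> foldr (mult G) ws \<one>\<^bsub>G\<^esub> = g}"
  assume le: "word_length G S g \<le> enat n"
  then have "?A \<noteq> {}"
    unfolding word_length_def by (auto simp: top_enat_def simp del: Collect_empty_eq)
  then obtain l where "l \<in> ?A"
    by blast
  then have "Inf ?A \<in> ?A"
    by (rule wellorder_InfI)
  then show ?word
    using le unfolding word_length_def by auto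
next
  assume ?word
  then obtain ws where "set ws \<subseteq> S \<union> m_inv G ` S" "foldr (mult G) ws \<one>\<^bsub>G\<^esub> = g"
    and n: "length ws \<le> n"
    by blast
  then have "word_length G S g \<le> enat (length ws)"
    unfolding word_length_def by (intro Inf_lower) blast
  also have "\<dots> \<le> enat n"
    using n by simp
  finally show "word_length G S g \<le> enat n" .
qed

lemma width_le_iff:
  "width G S \<le> enat n \<longleftrightarrow> (\<forall>g\<in>carrier G. word_length G S g \<le> enat n)"
  unfolding width_def by (simp add: SUP_le_iff)

lemma (in monoid) foldr_mult_closed:
  "set ws \<subseteq> carrier G \<Longrightarrow> foldr (mult G) ws \<one> \<in> carrier G"
  by (induction ws) auto

lemma (in monoid) foldr_mult_append:
  assumes "set vs \<subseteq> carrier G" "set ws \<subseteq> carrier G"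
  shows "foldr (mult G) (vs @ ws) \<one> = foldr (mult G) vs \<one> \<otimes> foldr (mult G) ws \<one>"
  using assms by (induction vs) (auto simp: m_assoc foldr_mult_closed)

lemma (in group) inv_foldr_mult:
  assumes "set ws \<subseteq> carrier G"
  shows "inv (foldr (mult G) ws \<one>) = foldr (mult G) (rev (map (m_inv G) ws)) \<one>"
  using assms
proof (induction ws)
  case (Cons w ws)
  then have "set (rev (map (m_inv G) ws)) \<subseteq> carrier G"
    by auto
  then show ?case
    using foldr_mult_append[of "rev (map (m_inv G) ws)" "[inv w]"] Cons
    by (simp add: inv_mult_group foldr_mult_closed)
qed simp

lemma (in group) conj_foldr_mult:
  assumes "set ws \<subseteq> carrier G" "g \<in> carrier G"
  shows "g \<otimes> foldr (mult G) ws \<one> \<otimes> inv g = foldr (mult G) (map (\<lambda>w. g \<otimes> w \<otimes> inv g) ws) \<one>"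
  using assms
proof (induction ws)
  case (Cons w ws)
  then show ?case
    by (simp add: conj_mult foldr_mult_closed)
qed simp

definition word_ball :: "('a, 'b) monoid_scheme \<Rightarrow> 'a set \<Rightarrow> nat \<Rightarrow> 'a set" where
  "word_ball G S n = {g \<in> carrier G. word_length G S g \<le> enat n}"

lemma (in group) word_ball_eq:
  assumes "S \<subseteq> carrier G"
  shows "word_ball G S n =
    {foldr (mult G) ws \<one> | ws. set ws \<subseteq> S \<union> m_inv G ` S \<and> length ws \<le> n}"
proof -
  have "S \<union> m_inv G ` S \<subseteq> carrier G"
    using assms by auto
  then have "foldr (mult G) ws \<one> \<in> carrier G" if "set ws \<subseteq> S \<union> m_inv G ` S" for ws
    by (rule foldr_mult_closed[OF subset_trans[OF that]])
  then show ?thesis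
    unfolding word_ball_def word_length_le_iff by auto
qed

lemma (in group) foldr_mult_in_word_ball:
  assumes "S \<subseteq> carrier G" "set ws \<subseteq> S \<union> m_inv G ` S" "length ws \<le> n"
  shows "foldr (mult G) ws \<one> \<in> word_ball G S n"
  using word_ball_eq assms by auto

lemma word_ball_mono:
  assumes "m \<le> n"
  shows "word_ball G S m \<subseteq> word_ball G S n"
proof -
  have "enat m \<le> enat n"
    using assms by simp
  then show ?thesis
    unfolding word_ball_def using order_trans by blast
qed

lemma (in group) word_ball_mult:
  assumes S: "S \<subseteq> carrier G" and x: "x \<in> word_ball G S m" and y: "y \<in> word_ball G S n"
  shows "x \<otimes> y \<in> word_ball G S (m + n)"
proof -
  have letters: "S \<union> m_inv G ` S \<subseteq> carrier G"
    using S by auto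
  obtain vs where vs: "x = foldr (mult G) vs \<one>" "set vs \<subseteq> S \<union> m_inv G ` S" "length vs \<le> m"
    using x S word_ball_eq by auto
  obtain ws where ws: "y = foldr (mult G) ws \<one>" "set ws \<subseteq> S \<union> m_inv G ` S" "length ws \<le> n"
    using y S word_ball_eq by auto
  have "x \<otimes> y = foldr (mult G) (vs @ ws) \<one>"
    unfolding vs(1) ws(1)
    by (rule foldr_mult_append[symmetric]) (use vs ws letters in blast)+
  moreover have "set (vs @ ws) \<subseteq> S \<union> m_inv G ` S" "length (vs @ ws) \<le> m + n"
    using vs ws by auto
  ultimately show ?thesis
    using foldr_mult_in_word_ball[OF S] by metis
qed

lemma (in group) word_ball_inv:
  assumes S: "S \<subseteq> carrier G" and x: "x \<in> word_ball G S n"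
  shows "inv x \<in> word_ball G S n"
proof -
  have letters: "S \<union> m_inv G ` S \<subseteq> carrier G"
    using S by auto
  obtain ws where ws: "x = foldr (mult G) ws \<one>" "set ws \<subseteq> S \<union> m_inv G ` S" "length ws \<le> n"
    using x S word_ball_eq by auto
  have "inv x = foldr (mult G) (rev (map (m_inv G) ws)) \<one>"
    unfolding ws(1) by (rule inv_foldr_mult) (use ws letters in blast)
  moreover have "inv w \<in> S \<union> m_inv G ` S" if "w \<in> S \<union> m_inv G ` S" for w
    using that S by auto
  then have "set (rev (map (m_inv G) ws)) \<subseteq> S \<union> m_inv G ` S"
    using ws(2) unfolding set_rev set_map by blast
  moreover have "length (rev (map (m_inv G) ws)) \<le> n"
    using ws by simp
  ultimately show ?thesis
    using foldr_mult_in_word_ball[OF S] by metis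
qed

lemma (in group) word_ball_conj:
  assumes S: "S \<subseteq> carrier G" and inv: "conjugation_invariant G S"
    and g: "g \<in> carrier G" and x: "x \<in> word_ball G S n"
  shows "g \<otimes> x \<otimes> inv g \<in> word_ball G S n"
proof -
  have letters: "S \<union> m_inv G ` S \<subseteq> carrier G"
    using S by auto
  obtain ws where ws: "x = foldr (mult G) ws \<one>" "set ws \<subseteq> S \<union> m_inv G ` S" "length ws \<le> n"
    using x S word_ball_eq by auto
  let ?c = "\<lambda>w. g \<otimes> w \<otimes> inv g"
  have "?c x = foldr (mult G) (map ?c ws) \<one>"
    unfolding ws(1) by (rule conj_foldr_mult) (use ws letters g in blast)+
  moreover have c: "?c s \<in> S" if "s \<in> S" for s
    using that inv g conjugation_invariant_iff[OF S] by blast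
  have "?c w \<in> S \<union> m_inv G ` S" if w: "w \<in> S \<union> m_inv G ` S" for w
  proof (cases "w \<in> S")
    case False
    then obtain s where s: "s \<in> S" "w = inv s"
      using w by blast
    then have "?c w = inv (?c s)"
      using inv_conj g S by auto
    then show ?thesis
      using c s by blast
  qed (use c in blast)
  then have "set (map ?c ws) \<subseteq> S \<union> m_inv G ` S"
    using ws(2) unfolding set_map by blast
  moreover have "length (map ?c ws) \<le> n"
    using ws by simp
  ultimately show ?thesis
    using foldr_mult_in_word_ball[OF S] by metis
qed

lemma (in group) generate_subset_word_balls:
  assumes S: "S \<subseteq> carrier G" and "g \<in> generate G S"
  shows "\<exists>n. g \<in> word_ball G S n"
  using assms(2)
proof induction
  case one
  show ?case
    using foldr_mult_in_word_ball[OF S, of "[]" 0] by auto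
next
  case (incl h)
  then have "h \<in> word_ball G S 1"
    using foldr_mult_in_word_ball[OF S, of "[h]" 1] S by auto
  then show ?case
    by blast
next
  case (inv h)
  then have "inv h \<in> word_ball G S 1"
    using foldr_mult_in_word_ball[OF S, of "[inv h]" 1] S by auto
  then show ?case
    by blast
next
  case (eng h1 h2)
  then obtain m n where "h1 \<in> word_ball G S m" "h2 \<in> word_ball G S n"
    by blast
  then show ?case
    by (intro exI[of _ "m + n"] word_ball_mult[OF S])
qed

section \<open>Finite width and normal chains versus chains of subsets\<close>

text \<open>For a generating set every element has a finite word length; this is where generation enters.\<close>

lemma (in group) word_ball_exhaustive_chain:
  assumes S: "S \<subseteq> carrier G" and gen: "generate G S = carrier G"
  shows "exhaustive_chain G (word_ball G S)"
proof (rule exhaustive_chainI)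
  show "word_ball G S k \<subseteq> carrier G" for k
    unfolding word_ball_def by blast
  show "word_ball G S k \<subseteq> word_ball G S (Suc k)" for k
    by (rule word_ball_mono) simp
  show "\<exists>k. g \<in> word_ball G S k" if "g \<in> carrier G" for g
    using generate_subset_word_balls[OF S, of g] gen that by simp
qed

text \<open>The word balls are the chain to apply the hypothesis to: products of two elements of radius \<open>i\<close>
  have radius \<open>2 i\<close>, and a ball that is the whole group is a bound for the width.\<close>

lemma (in group) subset_chains_imp_finite_C_width:
  assumes ii: "invariant_subset_chains_terminate G"
  shows "finite_C_width G"
  unfolding finite_C_width_def
proof (intro allI impI)
  fix S
  assume S: "S \<subseteq> carrier G" and gen: "generate G S = carrier G" and inv: "conjugation_invariant G S"
  have "terminates G (word_ball G S)"
  proof (rule invariant_subset_chains_terminateD[OF ii word_ball_exhaustive_chain[OF S gen]])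
    show "\<exists>k. \<forall>u\<in>word_ball G S i. \<forall>v\<in>word_ball G S i. u \<otimes> v \<in> word_ball G S k" for i
      by (intro exI[of _ "i + i"] ballI) (rule word_ball_mult[OF S])
  qed (rule word_ball_inv[OF S] word_ball_conj[OF S inv]; assumption)+
  then obtain m where "word_ball G S m = carrier G"
    unfolding terminates_def by blast
  then have "width G S \<le> enat m"
    unfolding width_le_iff word_ball_def by blast
  also have "\<dots> < \<infinity>"
    by simp
  finally show "width G S < \<infinity>" .
qed

lemma (in group) subset_chains_imp_normal_chains_terminate:
  assumes ii: "invariant_subset_chains_terminate G"
  shows "normal_chains_terminate G"
  unfolding normal_chains_terminate_def
proof (intro allI impI)
  fix N
  assume N: "exhaustive_chain G N" and normal: "\<forall>k. N k \<lhd> G"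
  have sub: "subgroup (N k) G" for k
    using normal normal_imp_subgroup by blast
  show "terminates G N"
  proof (rule invariant_subset_chains_terminateD[OF ii N])
    show "inv u \<in> N i" if "u \<in> N i" for i u
      using subgroup.m_inv_closed[OF sub that] .
    show "g \<otimes> u \<otimes> inv g \<in> N i" if "g \<in> carrier G" "u \<in> N i" for i g u
      using normal.inv_op_closed2[of "N i" G g u] normal that by blast
    show "\<exists>k. \<forall>u\<in>N i. \<forall>v\<in>N i. u \<otimes> v \<in> N k" for i
      by (intro exI[of _ i] ballI) (rule subgroup.m_closed[OF sub])
  qed
qed

lemma (in group) generate_exhaustive_chain:
  assumes "exhaustive_chain G U"
  shows "exhaustive_chain G (\<lambda>k. generate G (U k))"
proof (rule exhaustive_chainI)
  show "generate G (U k) \<subseteq> carrier G" for k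
    using generate_incl exhaustive_chain_subset[OF assms] by blast
  show "generate G (U k) \<subseteq> generate G (U (Suc k))" for k
    by (rule mono_generate) (use assms in \<open>simp add: exhaustive_chain_def\<close>)
  show "\<exists>k. g \<in> generate G (U k)" if g: "g \<in> carrier G" for g
  proof -
    obtain k where "g \<in> U k"
      using exhaustive_chain_obtain[OF assms g] .
    then show ?thesis
      by (intro exI[of _ k] generate.incl)
  qed
qed

text \<open>Multiplying a word by one more letter multiplies two elements of the larger of the two members that
  contain the letter and the word; the hypothesis sends the result into some later member. Induction on
  the length makes this uniform in the words.\<close>

lemma (in group) chain_absorbs_bounded_words:
  assumes U: "exhaustive_chain G U"
    and prod: "\<And>i. \<exists>k. \<forall>u\<in>U i. \<forall>v\<in>U i. u \<otimes> v \<in> U k"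
  shows "\<exists>k. \<forall>ws. set ws \<subseteq> U m \<longrightarrow> length ws \<le> n \<longrightarrow> foldr (mult G) ws \<one> \<in> U k"
proof (induction n)
  case 0
  obtain k where "\<one> \<in> U k"
    using exhaustive_chain_obtain[OF U one_closed] .
  then show ?case
    by auto
next
  case (Suc n)
  then obtain k where k: "\<And>ws. set ws \<subseteq> U m \<Longrightarrow> length ws \<le> n \<Longrightarrow> foldr (mult G) ws \<one> \<in> U k"
    by blast
  define i where "i = max m k"
  obtain j where j: "\<And>u v. u \<in> U i \<Longrightarrow> v \<in> U i \<Longrightarrow> u \<otimes> v \<in> U j"
    using prod by blast
  have sub: "U m \<subseteq> U i" "U k \<subseteq> U i" "U k \<subseteq> U (max k j)" "U j \<subseteq> U (max k j)"
    using exhaustive_chain_mono[OF U] unfolding i_def by simp_all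
  have "foldr (mult G) ws \<one> \<in> U (max k j)" if ws: "set ws \<subseteq> U m" "length ws \<le> Suc n" for ws
  proof (cases ws)
    case Nil
    then show ?thesis
      using k[of "[]"] sub(3) by auto
  next
    case (Cons v vs)
    then have "v \<in> U i" "foldr (mult G) vs \<one> \<in> U i"
      using ws k sub by auto
    then show ?thesis
      using j sub(4) Cons by auto
  qed
  then show ?case
    by blast
qed

text \<open>Two finiteness conditions act in succession: termination of normal chains supplies a member that
  generates \<open>G\<close>, and finite width then bounds the number of factors taken from this member.\<close>

lemma (in group) finite_C_width_imp_subset_chains:
  assumes width: "finite_C_width G" and normal: "normal_chains_terminate G"
  shows "invariant_subset_chains_terminate G"
  unfolding invariant_subset_chains_terminate_def
proof (intro allI impI)
  fix U
  assume U: "exhaustive_chain G U"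
    and cond: "\<forall>i. (\<forall>u\<in>U i. inv u \<in> U i) \<and> conjugation_invariant G (U i)
              \<and> (\<exists>k. U i <#>\<^bsub>G\<^esub> U i \<subseteq> U k)"
  have sub: "U k \<subseteq> carrier G" for k
    using exhaustive_chain_subset[OF U] .
  have "generate G (U k) \<lhd> G" for k
    by (rule normal_generateI[OF sub]) (use cond conjugation_invariant_iff[OF sub] in blast)
  then have "terminates G (\<lambda>k. generate G (U k))"
    using normal generate_exhaustive_chain[OF U] unfolding normal_chains_terminate_def by simp
  then obtain m where m: "generate G (U m) = carrier G"
    unfolding terminates_def by blast
  have "width G (U m) < \<infinity>"
    using width sub[of m] m cond unfolding finite_C_width_def by simp
  then obtain n where n: "width G (U m) \<le> enat n"
    by (cases "width G (U m)") auto
  obtain k where k: "\<And>ws. set ws \<subseteq> U m \<Longrightarrow> length ws \<le> n \<Longrightarrow> foldr (mult G) ws \<one> \<in> U k"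
    using chain_absorbs_bounded_words[OF U, of m n] cond unfolding set_mult_subset_iff by blast
  have letters: "U m \<union> m_inv G ` U m = U m"
    using cond by blast
  have "g \<in> U k" if "g \<in> carrier G" for g
  proof -
    have "word_length G (U m) g \<le> enat n"
      using n that unfolding width_le_iff by blast
    then show ?thesis
      unfolding word_length_le_iff letters using k by blast
  qed
  then show "terminates G U"
    unfolding terminates_def using sub by blast
qed

section \<open>Length functions and isometric actions\<close>

lemma (in group) subset_chains_imp_length_functions_bounded:
  assumes ii: "invariant_subset_chains_terminate G"
  shows "class_length_functions_bounded G"
  unfolding class_length_functions_bounded_def
proof (intro allI impI)
  fix L :: "'a \<Rightarrow> real"
  assume conj: "\<forall>g\<in>carrier G. \<forall>h\<in>carrier G. L (g \<otimes> h \<otimes> inv g) = L h"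
    and sub: "\<forall>g\<in>carrier G. \<forall>h\<in>carrier G. L (g \<otimes> h) \<le> L g + L h"
  \<comment> \<open>\<open>L\<close> need not be symmetric, so closure under inverses has to be built into the sublevel sets.\<close>
  define U where "U k = {g \<in> carrier G. L g \<le> real k \<and> L (inv g) \<le> real k}" for k :: nat
  have U: "exhaustive_chain G U"
  proof (rule exhaustive_chainI)
    show "\<exists>k. g \<in> U k" if "g \<in> carrier G" for g
    proof -
      obtain k where "max (L g) (L (inv g)) \<le> real k"
        using real_arch_simple by blast
      then show ?thesis
        using that unfolding U_def by auto
    qed
  qed (auto simp: U_def)
  have "terminates G U"
  proof (rule invariant_subset_chains_terminateD[OF ii U])
    show "inv u \<in> U i" if "u \<in> U i" for i u
      using that unfolding U_def by auto
    show "g \<otimes> u \<otimes> inv g \<in> U i" if "g \<in> carrier G" "u \<in> U i" for i g u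
      using that conj unfolding U_def by (auto simp: inv_conj)
    have "u \<otimes> v \<in> U (i + i)" if u: "u \<in> U i" and v: "v \<in> U i" for i u v
    proof -
      have "L (u \<otimes> v) \<le> L u + L v" "L (inv v \<otimes> inv u) \<le> L (inv v) + L (inv u)"
        using u v sub unfolding U_def by auto
      then show ?thesis
        using u v unfolding U_def by (auto simp: inv_mult_group)
    qed
    then show "\<exists>k. \<forall>u\<in>U i. \<forall>v\<in>U i. u \<otimes> v \<in> U k" for i
      by (intro exI[of _ "i + i"] ballI)
  qed
  then obtain m where "U m = carrier G"
    unfolding terminates_def by blast
  then have "L g \<le> real m" if "g \<in> carrier G" for g
    using that unfolding U_def by blast
  then show "bdd_above (L ` carrier G)"
    by (rule bdd_aboveI2)
qed

text \<open>By the triangle inequality and isometry, displacement at \<open>a\<close> is subadditive, and the distance of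
  two points \<open>g a\<close> and \<open>h a\<close> of the orbit is the displacement by \<open>g\<inverse> h\<close>. So an upper bound for the
  displacements bounds the diameter of the orbit.\<close>

lemma (in group) length_functions_imp_actions_bounded:
  assumes iv: "class_length_functions_bounded G"
  shows "class_invariant_actions_bounded G TYPE('m)"
  unfolding class_invariant_actions_bounded_def
proof (intro allI impI ballI)
  fix M :: "'m set" and d \<phi> a
  assume act: "isometric_action G M d \<phi>"
    and conj: "\<forall>a\<in>M. \<forall>g\<in>carrier G. \<forall>h\<in>carrier G. d a (\<phi> (g \<otimes> h \<otimes> inv g) a) = d a (\<phi> h a)"
    and a: "a \<in> M"
  interpret Metric_space M d
    using act unfolding isometric_action_def by blast
  interpret group_action G M \<phi>
    using act unfolding isometric_action_def by blast
  have iso: "d (\<phi> g x) (\<phi> g y) = d x y" if "g \<in> carrier G" "x \<in> M" "y \<in> M" for g x y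
    using act that unfolding isometric_action_def by blast
  \<comment> \<open>The displacement also vanishes on the stabilizer of \<open>a\<close>. Adding the discrete length, itself
    subadditive and conjugation-invariant, leaves \<open>\<one>\<close> as the only zero and changes \<open>L\<close> by at most \<open>1\<close>.\<close>
  define L where "L g = d a (\<phi> g a) + (if g = \<one> then 0 else 1)" for g
  have L_conj: "L (g \<otimes> h \<otimes> inv g) = L h" if g: "g \<in> carrier G" and h: "h \<in> carrier G" for g h
  proof -
    have "g \<otimes> h \<otimes> inv g = \<one> \<longleftrightarrow> h = \<one>"
    proof
      assume "g \<otimes> h \<otimes> inv g = \<one>"
      then have "g \<otimes> h = g"
        using g h by (metis inv_closed inv_equality inv_inv m_closed)
      then show "h = \<one>"
        using g h by simp
    qed (use g in simp)
    then show ?thesis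
      using conj a g h unfolding L_def by auto
  qed
  have "L g = 0 \<longleftrightarrow> g = \<one>" for g
  proof (cases "g = \<one>")
    case True
    have "\<phi> \<one> a = a"
      using fun_cong[OF id_eq_one, of a] a by simp
    then show ?thesis
      using True a unfolding L_def by simp
  next
    case False
    then have "0 < L g"
      unfolding L_def by (simp add: add_nonneg_pos)
    then show ?thesis
      using False by simp
  qed
  moreover have "L (g \<otimes> h) \<le> L g + L h" if g: "g \<in> carrier G" and h: "h \<in> carrier G" for g h
  proof -
    have ga: "\<phi> g a \<in> M" and ha: "\<phi> h a \<in> M"
      using element_image a g h by blast+
    have "\<phi> (g \<otimes> h) a = \<phi> g (\<phi> h a)"
      using composition_rule a g h by blast
    then have "d a (\<phi> (g \<otimes> h) a) \<le> d a (\<phi> g a) + d (\<phi> g a) (\<phi> g (\<phi> h a))"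
      using triangle[OF a ga] element_image[OF g ha] by simp
    also have "d (\<phi> g a) (\<phi> g (\<phi> h a)) = d a (\<phi> h a)"
      using iso g a ha by blast
    finally show ?thesis
      using g h unfolding L_def by auto
  qed
  ultimately have "bdd_above (L ` carrier G)"
    using iv[unfolded class_length_functions_bounded_def, rule_format, of L] L_conj by simp
  then obtain B where B: "\<And>g. g \<in> carrier G \<Longrightarrow> L g \<le> B"
    unfolding bdd_above_def by blast
  have "d x y \<le> B" if "x \<in> orbit G \<phi> a" "y \<in> orbit G \<phi> a" for x y
  proof -
    obtain g h where g: "g \<in> carrier G" "x = \<phi> g a" and h: "h \<in> carrier G" "y = \<phi> h a"
      using \<open>x \<in> orbit G \<phi> a\<close> \<open>y \<in> orbit G \<phi> a\<close> unfolding orbit_def by blast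
    have k: "inv g \<otimes> h \<in> carrier G"
      using g h by simp
    have "\<phi> g (\<phi> (inv g \<otimes> h) a) = \<phi> (g \<otimes> (inv g \<otimes> h)) a"
      using composition_rule[OF a g(1) k] by simp
    also have "g \<otimes> (inv g \<otimes> h) = h"
      using g h by (simp add: m_assoc[symmetric])
    finally have "d x y = d (\<phi> g a) (\<phi> g (\<phi> (inv g \<otimes> h) a))"
      using g h by simp
    also have "\<dots> = d a (\<phi> (inv g \<otimes> h) a)"
      using iso g(1) a element_image[OF k a] by blast
    also have "\<dots> \<le> B"
      using B[OF k] unfolding L_def by (auto split: if_splits)
    finally show ?thesis .
  qed
  then show "\<exists>B. \<forall>x\<in>orbit G \<phi> a. \<forall>y\<in>orbit G \<phi> a. d x y \<le> B"
    by blast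
qed

section \<open>The metric of a chain of subsets\<close>

text \<open>The chosen indices are strictly increasing, which ensures that the subsequence still
  exhausts \<open>G\<close>.\<close>

lemma (in group) doubling_subchain:
  assumes U: "exhaustive_chain G U"
    and prod: "\<And>i. \<exists>k. \<forall>u\<in>U i. \<forall>v\<in>U i. u \<otimes> v \<in> U k"
  shows "\<exists>f. exhaustive_chain G (\<lambda>n. U (f n)) \<and>
    (\<forall>n. \<forall>u\<in>U (f n). \<forall>v\<in>U (f n). u \<otimes> v \<in> U (f (Suc n)))"
proof -
  have "\<exists>j>i. \<forall>u\<in>U i. \<forall>v\<in>U i. u \<otimes> v \<in> U j" for i
  proof -
    obtain k where "\<forall>u\<in>U i. \<forall>v\<in>U i. u \<otimes> v \<in> U k"
      using prod by blast
    then have "\<forall>u\<in>U i. \<forall>v\<in>U i. u \<otimes> v \<in> U (max k (Suc i))"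
      using exhaustive_chain_mono[OF U, of k "max k (Suc i)"] by auto
    then show ?thesis
      by (intro exI[of _ "max k (Suc i)"]) auto
  qed
  then obtain f where f: "\<And>n. f n < f (Suc n)"
    "\<And>n. \<forall>u\<in>U (f n). \<forall>v\<in>U (f n). u \<otimes> v \<in> U (f (Suc n))"
    using dependent_nat_choice[of "\<lambda>_ _. True" "\<lambda>_ i j. i < j \<and> (\<forall>u\<in>U i. \<forall>v\<in>U i. u \<otimes> v \<in> U j)"]
    by blast
  have "n \<le> f n" for n
    using f(1) by (simp add: strict_mono_Suc_iff strict_mono_imp_increasing)
  have "exhaustive_chain G (\<lambda>n. U (f n))"
  proof (rule exhaustive_chainI)
    show "U (f k) \<subseteq> carrier G" for k
      using exhaustive_chain_subset[OF U] .
    show "U (f k) \<subseteq> U (f (Suc k))" for k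
      using exhaustive_chain_mono[OF U] f(1) less_imp_le by blast
    show "\<exists>k. g \<in> U (f k)" if g: "g \<in> carrier G" for g
    proof -
      obtain k where "g \<in> U k"
        using exhaustive_chain_obtain[OF U g] .
      then show ?thesis
        using exhaustive_chain_mono[OF U \<open>k \<le> f k\<close>] by blast
    qed
  qed
  then show ?thesis
    using f(2) by blast
qed

text \<open>The summand \<open>1\<close> pays for the step from \<open>V n\<close> to \<open>V (Suc n)\<close> in a product, and keeps the elements
  of \<open>V 0\<close> other than \<open>\<one>\<close> at positive length.\<close>

definition chain_length :: "('a, 'b) monoid_scheme \<Rightarrow> (nat \<Rightarrow> 'a set) \<Rightarrow> 'a \<Rightarrow> real" where
  "chain_length G V g = (if g = \<one>\<^bsub>G\<^esub> then 0 else 1 + real (LEAST n. g \<in> V n))"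

lemma chain_length_nonneg: "0 \<le> chain_length G V g"
  unfolding chain_length_def by simp

lemma chain_length_eq_0_iff: "chain_length G V g = 0 \<longleftrightarrow> g = \<one>\<^bsub>G\<^esub>"
  unfolding chain_length_def by auto

text \<open>If \<open>g\<close> and \<open>h\<close> first occur at \<open>m\<close> and \<open>n\<close>, then \<open>g h\<close> occurs by \<open>max m n + 1\<close>, and
  \<open>1 + (max m n + 1) \<le> (1 + m) + (1 + n)\<close>.\<close>

lemma (in group) chain_length_mult:
  assumes V: "exhaustive_chain G V"
    and doubling: "\<And>n u v. u \<in> V n \<Longrightarrow> v \<in> V n \<Longrightarrow> u \<otimes> v \<in> V (Suc n)"
    and g: "g \<in> carrier G" and h: "h \<in> carrier G"
  shows "chain_length G V (g \<otimes> h) \<le> chain_length G V g + chain_length G V h"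
proof (cases "g = \<one> \<or> h = \<one> \<or> g \<otimes> h = \<one>")
  case True
  then show ?thesis
    using g h chain_length_nonneg[of G V] chain_length_eq_0_iff[of G V]
    by (metis add.left_neutral add.right_neutral add_nonneg_nonneg l_one order_refl r_one)
next
  case False
  define m where "m = (LEAST n. g \<in> V n)"
  define n where "n = (LEAST n. h \<in> V n)"
  have "g \<in> V m" "h \<in> V n"
    unfolding m_def n_def using exhaustive_chain_Least[OF V] g h by simp_all
  then have "g \<in> V (max m n)" "h \<in> V (max m n)"
    using exhaustive_chain_mono[OF V, of m "max m n"] exhaustive_chain_mono[OF V, of n "max m n"]
    by auto
  then have "(LEAST k. g \<otimes> h \<in> V k) \<le> Suc (max m n)"
    using doubling by (intro Least_le)
  then show ?thesis
    using False unfolding chain_length_def m_def[symmetric] n_def[symmetric] by auto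
qed

lemma (in group) chain_length_inv:
  assumes V: "exhaustive_chain G V"
    and inv: "\<And>n u. u \<in> V n \<Longrightarrow> inv u \<in> V n"
    and g: "g \<in> carrier G"
  shows "chain_length G V (inv g) = chain_length G V g"
proof -
  have "inv g \<in> V n \<longleftrightarrow> g \<in> V n" for n
    using inv[of g n] inv[of "inv g" n] g by auto
  then show ?thesis
    using g unfolding chain_length_def by simp
qed

lemma (in group) chain_length_conj:
  assumes conj: "\<And>n g u. g \<in> carrier G \<Longrightarrow> u \<in> V n \<Longrightarrow> g \<otimes> u \<otimes> inv g \<in> V n"
    and g: "g \<in> carrier G" and h: "h \<in> carrier G"
  shows "chain_length G V (g \<otimes> h \<otimes> inv g) = chain_length G V h"
proof -
  have conj_back: "inv g \<otimes> (g \<otimes> h \<otimes> inv g) \<otimes> inv (inv g) = h"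
    using conj_conj_inv[of "inv g" h] g h by simp
  have "g \<otimes> h \<otimes> inv g \<in> V n \<longleftrightarrow> h \<in> V n" for n
    using conj[of g h n] conj[of "inv g" "g \<otimes> h \<otimes> inv g" n] g conj_back by auto
  moreover have "g \<otimes> h \<otimes> inv g = \<one> \<longleftrightarrow> h = \<one>"
    using conj_back g by force
  ultimately show ?thesis
    unfolding chain_length_def by simp
qed

lemma (in group) left_translation_action:
  "group_action G (carrier G) (\<lambda>g. \<lambda>x\<in>carrier G. g \<otimes> x)"
proof -
  let ?\<phi> = "\<lambda>g. \<lambda>x\<in>carrier G. g \<otimes> x"
  have bij: "?\<phi> g \<in> Bij (carrier G)" if g: "g \<in> carrier G" for g
  proof -
    have "bij_betw ((\<otimes>) g) (carrier G) (carrier G)"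
      using inj_on_cmult[OF g] surj_const_mult[OF g] unfolding bij_betw_def by blast
    then have "bij_betw (?\<phi> g) (carrier G) (carrier G)"
      using bij_betw_cong[of "carrier G" "?\<phi> g" "(\<otimes>) g"] by simp
    then show ?thesis
      unfolding Bij_def by simp
  qed
  have "?\<phi> (g \<otimes> h) = compose (carrier G) (?\<phi> g) (?\<phi> h)"
    if "g \<in> carrier G" "h \<in> carrier G" for g h
    using that by (auto simp: compose_def m_assoc)
  then have "?\<phi> \<in> hom G (BijGroup (carrier G))"
    using bij by (intro homI) (simp_all add: BijGroup_def)
  then show ?thesis
    by (intro group_action.intro group_hom.intro group_hom_axioms.intro group_BijGroup is_group)
qed

text \<open>The value \<open>0\<close> outside the carrier matters: \<^locale>\<open>Metric_space\<close> demands nonnegativity and symmetry on the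
  whole type, whereas \<open>L\<close> is controlled only on the group.\<close>

lemma (in group) left_invariant_Metric_space:
  fixes L :: "'a \<Rightarrow> real"
  assumes nonneg: "\<And>g. g \<in> carrier G \<Longrightarrow> 0 \<le> L g"
    and zero: "\<And>g. g \<in> carrier G \<Longrightarrow> L g = 0 \<longleftrightarrow> g = \<one>"
    and symm: "\<And>g. g \<in> carrier G \<Longrightarrow> L (inv g) = L g"
    and subadd: "\<And>g h. g \<in> carrier G \<Longrightarrow> h \<in> carrier G \<Longrightarrow> L (g \<otimes> h) \<le> L g + L h"
  shows "Metric_space (carrier G)
    (\<lambda>x y. if x \<in> carrier G \<and> y \<in> carrier G then L (inv x \<otimes> y) else 0)"
    (is "Metric_space _ ?d")
proof
  show "0 \<le> ?d x y" for x y
    using nonneg by simp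
  show "?d x y = ?d y x" for x y
    using symm[of "inv x \<otimes> y"] by (auto simp: inv_mult_group)
  show "?d x y = 0 \<longleftrightarrow> x = y" if x: "x \<in> carrier G" and y: "y \<in> carrier G" for x y
  proof -
    have "inv x \<otimes> y = \<one> \<longleftrightarrow> x = y"
      using x y inv_solve_left'[of \<one> x y] by auto
    then show ?thesis
      using x y zero by simp
  qed
  show "?d x z \<le> ?d x y + ?d y z"
    if x: "x \<in> carrier G" and y: "y \<in> carrier G" and z: "z \<in> carrier G" for x y z
  proof -
    have "(inv x \<otimes> y) \<otimes> (inv y \<otimes> z) = inv x \<otimes> ((y \<otimes> inv y) \<otimes> z)"
      using x y z by (simp only: m_assoc m_closed inv_closed)
    then have "inv x \<otimes> z = (inv x \<otimes> y) \<otimes> (inv y \<otimes> z)"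
      using x y z by simp
    then show ?thesis
      using x y z subadd[of "inv x \<otimes> y" "inv y \<otimes> z"] by simp
  qed
qed

text \<open>Left translation is isometric for the metric \<open>L (x\<inverse> y)\<close>, and it moves \<open>a\<close> to \<open>h a\<close> over the distance
  \<open>L (a\<inverse> h a) = L h\<close>. So the displacement by \<open>h\<close> is the same at every point, and it depends only on
  the conjugacy class of \<open>h\<close>, as the hypothesis on actions requires. The group is a single orbit, and
  the distances from \<open>\<one>\<close> are the values of \<open>L\<close>.\<close>

lemma (in group) invariant_length_bounded:
  fixes L :: "'a \<Rightarrow> real"
  assumes iii: "class_invariant_actions_bounded G TYPE('a)"
    and nonneg: "\<And>g. g \<in> carrier G \<Longrightarrow> 0 \<le> L g"
    and zero: "\<And>g. g \<in> carrier G \<Longrightarrow> L g = 0 \<longleftrightarrow> g = \<one>"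
    and symm: "\<And>g. g \<in> carrier G \<Longrightarrow> L (inv g) = L g"
    and subadd: "\<And>g h. g \<in> carrier G \<Longrightarrow> h \<in> carrier G \<Longrightarrow> L (g \<otimes> h) \<le> L g + L h"
    and conj: "\<And>g h. g \<in> carrier G \<Longrightarrow> h \<in> carrier G \<Longrightarrow> L (g \<otimes> h \<otimes> inv g) = L h"
  shows "bdd_above (L ` carrier G)"
proof -
  define d where "d x y = (if x \<in> carrier G \<and> y \<in> carrier G then L (inv x \<otimes> y) else 0)" for x y
  define \<phi> where "\<phi> g = (\<lambda>x\<in>carrier G. g \<otimes> x)" for g
  have d: "d x y = L (inv x \<otimes> y)" if "x \<in> carrier G" "y \<in> carrier G" for x y
    using that unfolding d_def by simp
  have \<phi>: "\<phi> g x = g \<otimes> x" if "x \<in> carrier G" for g x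
    using that unfolding \<phi>_def by simp
  have "Metric_space (carrier G) d"
    using left_invariant_Metric_space[of L] nonneg zero symm subadd unfolding d_def by blast
  moreover have "group_action G (carrier G) \<phi>"
    using left_translation_action unfolding \<phi>_def .
  moreover have "d (\<phi> g x) (\<phi> g y) = d x y"
    if g: "g \<in> carrier G" and x: "x \<in> carrier G" and y: "y \<in> carrier G" for g x y
  proof -
    have "inv (g \<otimes> x) \<otimes> (g \<otimes> y) = inv x \<otimes> ((inv g \<otimes> g) \<otimes> y)"
      using g x y by (simp only: inv_mult_group m_assoc m_closed inv_closed)
    then have "inv (g \<otimes> x) \<otimes> (g \<otimes> y) = inv x \<otimes> y"
      using g x y by simp
    then show ?thesis
      using g x y by (simp add: d \<phi>)
  qed
  ultimately have act: "isometric_action G (carrier G) d \<phi>"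
    unfolding isometric_action_def by blast
  have dist: "d a (\<phi> h a) = L h" if a: "a \<in> carrier G" and h: "h \<in> carrier G" for a h
    using conj[of "inv a" h] a h by (simp add: d \<phi> m_assoc)
  have "\<exists>B. \<forall>x\<in>orbit G \<phi> \<one>. \<forall>y\<in>orbit G \<phi> \<one>. d x y \<le> B"
    by (rule iii[unfolded class_invariant_actions_bounded_def, rule_format, OF act _ one_closed])
      (simp add: dist conj)
  then obtain B where B: "\<forall>x\<in>orbit G \<phi> \<one>. \<forall>y\<in>orbit G \<phi> \<one>. d x y \<le> B"
    by blast
  have "L g \<le> B" if g: "g \<in> carrier G" for g
  proof -
    have "\<phi> \<one> \<one> \<in> orbit G \<phi> \<one>" "\<phi> g \<one> \<in> orbit G \<phi> \<one>"
      using g unfolding orbit_def by blast+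
    then have "d (\<phi> \<one> \<one>) (\<phi> g \<one>) \<le> B"
      using B by blast
    then show ?thesis
      using g by (simp add: d \<phi>)
  qed
  then show ?thesis
    by (rule bdd_aboveI2)
qed

lemma (in group) actions_bounded_imp_subset_chains:
  assumes iii: "class_invariant_actions_bounded G TYPE('a)"
  shows "invariant_subset_chains_terminate G"
  unfolding invariant_subset_chains_terminate_def
proof (intro allI impI)
  fix U
  assume U: "exhaustive_chain G U"
    and cond: "\<forall>i. (\<forall>u\<in>U i. inv u \<in> U i) \<and> conjugation_invariant G (U i)
              \<and> (\<exists>k. U i <#>\<^bsub>G\<^esub> U i \<subseteq> U k)"
  have prod: "\<exists>k. \<forall>u\<in>U i. \<forall>v\<in>U i. u \<otimes> v \<in> U k" for i
    using cond unfolding set_mult_subset_iff by blast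
  obtain f where f: "exhaustive_chain G (\<lambda>n. U (f n))"
    and doubling: "\<forall>n. \<forall>u\<in>U (f n). \<forall>v\<in>U (f n). u \<otimes> v \<in> U (f (Suc n))"
    using doubling_subchain[OF U prod] by blast
  define V where "V n = U (f n)" for n
  have V: "exhaustive_chain G V"
    using f unfolding V_def .
  have V_mult: "u \<otimes> v \<in> V (Suc n)" if "u \<in> V n" "v \<in> V n" for n u v
    using doubling that unfolding V_def by blast
  have V_inv: "inv u \<in> V n" if "u \<in> V n" for n u
    using that cond unfolding V_def by blast
  have V_conj: "g \<otimes> u \<otimes> inv g \<in> V n" if "g \<in> carrier G" "u \<in> V n" for n g u
    using that cond conjugation_invariant_iff[OF exhaustive_chain_subset[OF U]]
    unfolding V_def by blast
  have "bdd_above (chain_length G V ` carrier G)"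
  proof (rule invariant_length_bounded[OF iii])
    show "chain_length G V (inv g) = chain_length G V g" if "g \<in> carrier G" for g
      using chain_length_inv[OF V V_inv that] .
    show "chain_length G V (g \<otimes> h) \<le> chain_length G V g + chain_length G V h"
      if "g \<in> carrier G" "h \<in> carrier G" for g h
      using chain_length_mult[OF V V_mult that] .
    show "chain_length G V (g \<otimes> h \<otimes> inv g) = chain_length G V h"
      if "g \<in> carrier G" "h \<in> carrier G" for g h
      using chain_length_conj[OF V_conj that] .
  qed (simp_all add: chain_length_nonneg chain_length_eq_0_iff)
  then obtain B where B: "\<And>g. g \<in> carrier G \<Longrightarrow> chain_length G V g \<le> B"
    unfolding bdd_above_def by blast
  obtain b where b: "B \<le> real b"
    using real_arch_simple by blast
  obtain c where c: "\<one> \<in> V c"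
    using exhaustive_chain_obtain[OF V one_closed] .
  \<comment> \<open>The length gives no information on the first member containing \<open>\<one>\<close>, hence the separate index \<open>c\<close>.\<close>
  have "g \<in> V (max b c)" if g: "g \<in> carrier G" for g
  proof (cases "g = \<one>")
    case True
    then show ?thesis
      using c exhaustive_chain_mono[OF V, of c "max b c"] by auto
  next
    case False
    have "g \<in> V (LEAST n. g \<in> V n)"
      by (rule exhaustive_chain_Least[OF V g])
    moreover have "(LEAST n. g \<in> V n) \<le> max b c"
      using B[OF g] b False unfolding chain_length_def by simp
    ultimately show ?thesis
      using exhaustive_chain_mono[OF V] by blast
  qed
  then have "U (f (max b c)) = carrier G"
    using exhaustive_chain_subset[OF U] unfolding V_def by blast
  then show "terminates G U"
    unfolding terminates_def by blast
qed

theorem proposition3p4: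
  fixes G :: "('a, 'b) monoid_scheme"
  assumes "group G"
  shows "((finite_C_width G \<and> normal_chains_terminate G)
            \<longleftrightarrow> invariant_subset_chains_terminate G)
       \<and> (invariant_subset_chains_terminate G
            \<longleftrightarrow> class_invariant_actions_bounded G TYPE('a))
       \<and> (class_invariant_actions_bounded G TYPE('a)
            \<longleftrightarrow> class_length_functions_bounded G)
       \<and> (class_length_functions_bounded G
            \<longrightarrow> class_invariant_actions_bounded G TYPE('m))"
proof -
  interpret group G
    by fact
  have "(finite_C_width G \<and> normal_chains_terminate G) \<longleftrightarrow> invariant_subset_chains_terminate G"
    using finite_C_width_imp_subset_chains subset_chains_imp_finite_C_width
      subset_chains_imp_normal_chains_terminate by blast
  moreover have "invariant_subset_chains_terminate G \<Longrightarrow> class_length_functions_bounded G"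
    by (rule subset_chains_imp_length_functions_bounded)
  moreover have "class_length_functions_bounded G \<Longrightarrow> class_invariant_actions_bounded G TYPE('a)"
    by (rule length_functions_imp_actions_bounded)
  moreover have "class_invariant_actions_bounded G TYPE('a) \<Longrightarrow> invariant_subset_chains_terminate G"
    by (rule actions_bounded_imp_subset_chains)
  moreover have "class_length_functions_bounded G \<Longrightarrow> class_invariant_actions_bounded G TYPE('m)"
    by (rule length_functions_imp_actions_bounded)
  ultimately show ?thesis
    by blast
qed

end
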